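(* Let $K$ be a field. For every $T\in\mathbb{P}$, in the algebra $K\{x\}$ of planar polynomials, $$(1+x)^T=\sum_{S\in\mathbb{P}}\binom{T}{S}\,x^S.$$
   Context: $\mathbb{P}$ is the set of isomorphism classes of finite planar reduced rooted trees: finite rooted trees in which the children of every vertex are linearly ordered and no vertex has exactly one child. The empty tree $\underline{1}$ is included in $\mathbb{P}$; $x$ also denotes the tree with a single vertex. $L(T)$ is the set of leaves (vertices without children) of $T$ and $\deg(T)=\#L(T)$. For $m\ge 2$ and nonempty $T_1,\dots,T_m$, the $m$-ary grafting $\cdot_m(T_1,\dots,T_m)=T_1\cdots T_m$ is the tree whose root has exactly $m$ children, which are, in order, the roots of $T_1,\dots,T_m$. Contraction: for $I\subseteq L(T)$, $T|I\in\mathbb{P}$ is $\underline{1}$ if $I=\emptyset$; otherwise keep exactly the vertices of $T$ on a path from the root to a leaf in $I$, with the inherited order, and suppress every vertex having exactly one child (if this is the root, delete it and let its child be the new root, repeatedly). $\binom{T}{S}$ is the number of $I\subseteq L(T)$ with $T|I$ isomorphic to $S$. $K\{x\}$ is the $K$-vector space with basis $\mathbb{P}$; the basis element of $S\in\mathbb{P}$ is written $x^S$, with $x^{\underline{1}}=1$ and $x^x=x$. For each $m\ge2$ it carries the $K$-multilinear operation $\cdot_m$ extending $m$-ary grafting of trees, where empty trees among the arguments are simply omitted: if exactly $k$ of the $m$ trees are nonempty, the result is the $k$-ary grafting of these in order if $k\ge 2$, the single nonempty tree if $k=1$, and $\underline{1}$ if $k=0$. For $T\ne\underline{1}$ of degree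 $n$, the $K$-multilinear operation $\cdot_T:K\{x\}^n\to K\{x\}$ (grafting the $i$-th argument at the $i$-th leaf of $T$) is given by $\cdot_x(f)=f$ and, for $T=T_1\cdots T_m$ with $T_i$ nonempty of degree $n_i$, $\cdot_T(f_1,\dots,f_n)=\cdot_m(\cdot_{T_1}(f_1,\dots,f_{n_1}),\dots,\cdot_{T_m}(f_{n-n_m+1},\dots,f_n))$. The $T$-th power of $f\in K\{x\}$ is $f^T=\cdot_T(f,\dots,f)$; also $f^{\underline{1}}=1$. *)

theory Defs
  imports "HOL-Library.Poly_Mapping"
begin

text \<open>
  Finite planar rooted trees: a vertex is given by the list of its children, in order. Two such
  trees are isomorphic iff they are equal as terms, so terms represent isomorphism classes.
\<close>

datatype rtree = Vertex "rtree list"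

fun reduced :: "rtree \<Rightarrow> bool" where
  "reduced (Vertex ts) \<longleftrightarrow> length ts \<noteq> 1 \<and> (\<forall>t\<in>set ts. reduced t)"

text \<open>
  The set of reduced trees together with the empty tree; the latter is represented by \<open>None\<close>.
\<close>

typedef ptree = "{T. \<forall>t. T = Some t \<longrightarrow> reduced t}"
  by (rule exI[of _ None]) simp

setup_lifting type_definition_ptree

lift_definition empty_tree :: ptree is None
  by simp

lift_definition leaf_tree :: ptree is "Some (Vertex [])"
  by simp

text \<open>
  A vertex is addressed by the list of (zero-based) child positions on the path from the root.
\<close>

function rleaves :: "rtree \<Rightarrow> nat list set" where
  "rleaves (Vertex ts) =
     (if ts = [] then {[]} else (\<Union>i\<in>{..<length ts}. (#) i ` rleaves (ts ! i)))"
  by pat_completeness auto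
termination
  by (relation "measure size")
    (auto simp: less_Suc_eq_le intro!: size_list_estimation' nth_mem)

lift_definition leaves :: "ptree \<Rightarrow> nat list set" is
  "\<lambda>T. case T of None \<Rightarrow> {} | Some t \<Rightarrow> rleaves t" .

text \<open>
  \<open>prune t I\<close> keeps the vertices on a path from the root to a leaf in \<open>I\<close>, for nonempty
  \<open>I \<subseteq> rleaves t\<close>.
\<close>

function prune :: "rtree \<Rightarrow> nat list set \<Rightarrow> rtree" where
  "prune (Vertex ts) I =
     Vertex (map (\<lambda>i. prune (ts ! i) {p. i # p \<in> I})
       (filter (\<lambda>i. \<exists>p. i # p \<in> I) [0..<length ts]))"
  by pat_completeness auto
termination
  by (relation "measure (size \<circ> fst)")
    (auto simp: less_Suc_eq_le intro!: size_list_estimation' nth_mem)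

fun suppress :: "rtree \<Rightarrow> rtree" where
  "suppress (Vertex [t]) = suppress t"
| "suppress (Vertex ts) = Vertex (map suppress ts)"

lemma reduced_suppress: "reduced (suppress t)"
  by (induction t rule: suppress.induct) auto

lift_definition contract :: "ptree \<Rightarrow> nat list set \<Rightarrow> ptree" is
  "\<lambda>T I. case T of None \<Rightarrow> None
     | Some t \<Rightarrow> if I = {} then None else Some (suppress (prune t I))"
  by (auto simp: reduced_suppress split: option.splits if_splits)

definition tree_binomial :: "ptree \<Rightarrow> ptree \<Rightarrow> nat" where
  "tree_binomial T S = card {I. I \<subseteq> leaves T \<and> contract T I = S}"

lemma finite_rleaves: "finite (rleaves t)"
  by (induction t rule: rleaves.induct) auto

lemma finite_leaves: "finite (leaves T)"
  by transfer (auto simp: finite_rleaves split: option.splits)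

text \<open>
  \<open>Sum_any\<close> returns 0 for a family of infinite support, so finiteness matters for the sum over
  all trees.
\<close>

lemma finite_tree_binomial: "finite {S. tree_binomial T S \<noteq> 0}"
proof (rule finite_subset)
  show "{S. tree_binomial T S \<noteq> 0} \<subseteq> contract T ` Pow (leaves T)"
    by (auto simp: tree_binomial_def card_eq_0_iff)
qed (simp add: finite_leaves)

definition graft_nonempty :: "rtree list \<Rightarrow> rtree option" where
  "graft_nonempty ts = (case ts of [] \<Rightarrow> None | [t] \<Rightarrow> Some t | _ \<Rightarrow> Some (Vertex ts))"

lemma reduced_graft_nonempty:
  "\<forall>t\<in>set ts. reduced t \<Longrightarrow> graft_nonempty ts = Some u \<Longrightarrow> reduced u"
  by (auto simp: graft_nonempty_def split: list.splits)

text \<open>\<open>List.map_filter id\<close> drops the empty trees among the arguments.\<close>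

lift_definition graft :: "ptree list \<Rightarrow> ptree" is
  "\<lambda>Ts. graft_nonempty (List.map_filter id Ts)"
  by (erule reduced_graft_nonempty[rotated])
    (auto simp: list_all_iff List.map_filter_def)

type_synonym 'k planar_poly = "ptree \<Rightarrow>\<^sub>0 'k"

definition basis :: "ptree \<Rightarrow> 'k::field planar_poly" where
  "basis S = Poly_Mapping.single S 1"

definition scale :: "'k::field \<Rightarrow> 'k planar_poly \<Rightarrow> 'k planar_poly" where
  "scale c f = Poly_Mapping.map ((*) c) f"

text \<open>
  The \<open>m\<close>-linear extension of grafting, where \<open>m\<close> is the length of the argument list: the sum
  ranges over all choices of one tree from the support of each argument.
\<close>

definition graft_poly :: "'k::field planar_poly list \<Rightarrow> 'k planar_poly" where
  "graft_poly fs =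
     (\<Sum>Ts\<in>listset (map Poly_Mapping.keys fs).
        scale (\<Prod>i<length fs. Poly_Mapping.lookup (fs ! i) (Ts ! i)) (basis (graft Ts)))"

text \<open>
  \<open>subst_tree t fs\<close> grafts the entries of \<open>fs\<close> at the leaves of \<open>t\<close> from left to right;
  the length of \<open>fs\<close> is meant to be the degree of \<open>t\<close>.
\<close>

fun subst_tree :: "rtree \<Rightarrow> 'k::field planar_poly list \<Rightarrow> 'k planar_poly"
  and subst_trees :: "rtree list \<Rightarrow> 'k::field planar_poly list \<Rightarrow> 'k planar_poly list" where
  "subst_tree (Vertex []) fs = hd fs"
| "subst_tree (Vertex (t # ts)) fs = graft_poly (subst_trees (t # ts) fs)"
| "subst_trees [] fs = []"
| "subst_trees (t # ts) fs =
     subst_tree t (take (card (rleaves t)) fs) # subst_trees ts (drop (card (rleaves t)) fs)"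

definition tree_power :: "'k::field planar_poly \<Rightarrow> ptree \<Rightarrow> 'k planar_poly" where
  "tree_power f T = (case Rep_ptree T of None \<Rightarrow> basis empty_tree
     | Some t \<Rightarrow> subst_tree t (replicate (card (rleaves t)) f))"

end

theory Submission
  imports Defs
begin

text \<open>
  More generally, for every planar tree \<open>t\<close>, reduced or not, \<open>(1 + x)\<^sup>t\<close> is the sum of \<open>x\<^bsup>t|I\<^esup>\<close> over
  all sets \<open>I\<close> of leaves. This goes by induction on \<open>t\<close>: multilinearity of grafting expands the power
  into a sum over all choices of a leaf set in each branch, such choices correspond to leaf sets of \<open>t\<close>,
  and grafting with empty arguments omitted is exactly what contraction does at the root. Collecting
  equal terms gives the binomial coefficients.
\<close>

section \<open>Scalar multiples and sums over lists of choices\<close>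

lemma lookup_scale [simp]: "Poly_Mapping.lookup (scale c f) S = c * Poly_Mapping.lookup f S"
  by (simp add: scale_def Poly_Mapping.map.rep_eq when_def)

lemma scale_one [simp]: "scale 1 f = f"
  by (rule poly_mapping_eqI) simp

lemma scale_zero [simp]: "scale 0 f = 0"
  by (rule poly_mapping_eqI) simp

lemma scale_scale: "scale a (scale b f) = scale (a * b) f"
  by (rule poly_mapping_eqI) simp

lemma scale_sum: "scale c (sum g A) = (\<Sum>a\<in>A. scale c (g a))"
  by (rule poly_mapping_eqI) (simp add: lookup_sum sum_distrib_left)

lemma sum_scale: "(\<Sum>a\<in>A. scale (c a) f) = scale (sum c A) f"
  by (rule poly_mapping_eqI) (simp add: lookup_sum sum_distrib_right)

lemma sum_const_scale: "(\<Sum>a\<in>A. f) = scale (of_nat (card A)) f"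
  using sum_scale[of "\<lambda>_. 1" f A] by simp

lemma sum_listset_Cons:
  "(\<Sum>xs\<in>listset (A # As). h xs) = (\<Sum>x\<in>A. \<Sum>xs\<in>listset As. h (x # xs))"
proof -
  have "listset (A # As) = case_prod (#) ` (A \<times> listset As)"
    by (auto simp: set_Cons_def)
  moreover have "inj_on (case_prod (#)) (A \<times> listset As)"
    by (auto simp: inj_on_def)
  ultimately show ?thesis
    by (simp add: sum.reindex sum.cartesian_product case_prod_unfold)
qed

lemma in_listset_iff:
  "xs \<in> listset As \<longleftrightarrow> length xs = length As \<and> (\<forall>i<length As. xs ! i \<in> As ! i)"
proof (induction As arbitrary: xs)
  case (Cons A As)
  then show ?case
    by (cases xs) (auto simp: set_Cons_def nth_Cons less_Suc_eq_0_disj split: nat.splits)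
qed auto

section \<open>Multilinear extension of maps on lists of trees\<close>

definition multilinear_extension ::
  "(ptree list \<Rightarrow> ptree) \<Rightarrow> 'k::field planar_poly list \<Rightarrow> 'k planar_poly" where
  "multilinear_extension F fs =
     (\<Sum>Ts\<in>listset (map Poly_Mapping.keys fs).
        scale (\<Prod>i<length fs. Poly_Mapping.lookup (fs ! i) (Ts ! i)) (basis (F Ts)))"

lemma multilinear_extension_Nil [simp]: "multilinear_extension F [] = basis (F [])"
  by (simp add: multilinear_extension_def)

text \<open>Fixing the first tree turns \<open>F\<close> into another map on lists. Hence the
  extension is defined for arbitrary \<open>F\<close>; for \<open>graft\<close> it is
  \<open>graft_poly\<close>.\<close>

lemma multilinear_extension_Cons:
  "multilinear_extension F (f # fs) =
     (\<Sum>T\<in>Poly_Mapping.keys f.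
        scale (Poly_Mapping.lookup f T) (multilinear_extension (\<lambda>Ts. F (T # Ts)) fs))"
  by (simp add: multilinear_extension_def sum_listset_Cons scale_sum scale_scale
      prod.lessThan_Suc_shift del: listset.simps prod.lessThan_Suc)

text \<open>Different \<open>a\<close> may give the same tree, so the coefficient of
  \<open>f\<close> at \<open>T\<close> counts the fibre of \<open>c\<close> over \<open>T\<close>;
  summing fibre by fibre undoes this collection.\<close>

lemma sum_keys_sum_basis:
  fixes c :: "'a \<Rightarrow> ptree" and g :: "ptree \<Rightarrow> 'k::field planar_poly"
  assumes "finite A"
  defines "f \<equiv> (\<Sum>a\<in>A. basis (c a))"
  shows "(\<Sum>T\<in>Poly_Mapping.keys f. scale (Poly_Mapping.lookup f T) (g T)) = (\<Sum>a\<in>A. g (c a))"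
proof -
  have lookup_f: "Poly_Mapping.lookup f T = of_nat (card {a \<in> A. c a = T})" for T
    using assms by (simp add: lookup_sum basis_def lookup_single when_def sum.If_cases Int_def)
  have "Poly_Mapping.keys f \<subseteq> c ` A"
  proof
    fix T assume "T \<in> Poly_Mapping.keys f"
    then have "Poly_Mapping.lookup f T \<noteq> 0"
      by (simp add: in_keys_iff)
    then have "{a \<in> A. c a = T} \<noteq> {}"
      unfolding lookup_f by force
    then show "T \<in> c ` A" by auto
  qed
  \<comment> \<open>The inclusion can be strict in positive characteristic, where a fibre size may
    become 0; such trees contribute zero.\<close>
  then have "(\<Sum>T\<in>Poly_Mapping.keys f. scale (Poly_Mapping.lookup f T) (g T)) =
      (\<Sum>T\<in>c ` A. scale (Poly_Mapping.lookup f T) (g T))"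
    using assms(1) by (intro sum.mono_neutral_left) (auto simp: in_keys_iff)
  also have "\<dots> = (\<Sum>T\<in>c ` A. \<Sum>a\<in>{a \<in> A. c a = T}. g (c a))"
    by (simp add: lookup_f sum_const_scale)
  also have "\<dots> = (\<Sum>a\<in>A. g (c a))"
    using assms(1) by (rule sum.image_gen[symmetric])
  finally show ?thesis .
qed

text \<open>Induction on \<open>ts\<close> with \<open>F\<close> arbitrary:
  \<open>sum_keys_sum_basis\<close> expands the first argument, and the induction hypothesis is
  applied to \<open>F\<close> with its first tree fixed.\<close>

lemma multilinear_extension_sum_basis:
  assumes "\<And>t. t \<in> set ts \<Longrightarrow> finite (A t)"
  shows "multilinear_extension F (map (\<lambda>t. \<Sum>a\<in>A t. basis (c t a)) ts) =
    (\<Sum>as\<in>listset (map A ts). basis (F (map2 c ts as)))"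
  using assms
proof (induction ts arbitrary: F)
  case (Cons t ts)
  then show ?case
    by (simp add: multilinear_extension_Cons sum_keys_sum_basis sum_listset_Cons
        del: listset.simps(2))
qed simp

section \<open>Powers at a vertex with children\<close>

lemma subst_trees_replicate:
  "subst_trees ts (replicate (\<Sum>t\<leftarrow>ts. card (rleaves t)) f) =
     map (\<lambda>t. subst_tree t (replicate (card (rleaves t)) f)) ts"
  by (induction ts) (simp_all add: min_def)

text \<open>Addresses through different children differ in their first entry. A single vertex is
  excluded: it has one leaf, but the sum would be 0.\<close>

lemma card_rleaves_Vertex:
  assumes "ts \<noteq> []"
  shows "card (rleaves (Vertex ts)) = (\<Sum>t\<leftarrow>ts. card (rleaves t))"
proof -
  have "card (rleaves (Vertex ts)) = (\<Sum>i<length ts. card ((#) i ` rleaves (ts ! i)))"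
    using assms by (simp, subst card_UN_disjoint) (auto simp: finite_rleaves)
  also have "\<dots> = (\<Sum>i<length ts. card (rleaves (ts ! i)))"
    by (simp add: card_image)
  also have "\<dots> = (\<Sum>t\<leftarrow>ts. card (rleaves t))"
    by (simp add: sum_list_sum_nth atLeast0LessThan)
  finally show ?thesis .
qed

lemma subst_tree_Vertex_replicate:
  assumes "ts \<noteq> []"
  shows "subst_tree (Vertex ts) (replicate (card (rleaves (Vertex ts))) f) =
    multilinear_extension graft (map (\<lambda>t. subst_tree t (replicate (card (rleaves t)) f)) ts)"
  using assms subst_trees_replicate[of ts f]
  by (cases ts)
    (simp_all add: card_rleaves_Vertex graft_poly_def multilinear_extension_def
      del: subst_trees.simps rleaves.simps)

section \<open>Contraction at the root\<close>

lift_definition rcontract :: "rtree \<Rightarrow> nat list set \<Rightarrow> ptree" is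
  "\<lambda>t I. if I = {} then None else Some (suppress (prune t I))"
  by (auto simp: reduced_suppress split: if_splits)

text \<open>\<open>rcontract\<close> is defined on all of \<open>rtree\<close>, so that structural
  induction is available; this leads back to \<open>ptree\<close>.\<close>

lemma contract_eq_rcontract: "Rep_ptree T = Some t \<Longrightarrow> contract T I = rcontract t I"
  by transfer simp

text \<open>With one child both sides reduce to that child suppressed; with two or more both keep
  the root.\<close>

lemma suppress_Vertex: "us \<noteq> [] \<Longrightarrow> graft_nonempty (map suppress us) = Some (suppress (Vertex us))"
  by (cases us rule: list.exhaust[case_product list.exhaust, of _ "tl us"])
    (auto simp: graft_nonempty_def split: list.splits)

text \<open>Children without a leaf in \<open>I\<close> contract to the empty tree, which
  \<open>graft\<close> drops; the surviving ones are exactly those kept by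
  \<open>prune\<close>.\<close>

lemma rcontract_Vertex:
  assumes "ts \<noteq> []" and "I \<subseteq> rleaves (Vertex ts)"
  shows "rcontract (Vertex ts) I =
    graft (map (\<lambda>i. rcontract (ts ! i) {p. i # p \<in> I}) [0..<length ts])"
proof (rule Rep_ptree_inject[THEN iffD1])
  let ?js = "filter (\<lambda>i. \<exists>p. i # p \<in> I) [0..<length ts]"
  let ?us = "map (\<lambda>i. prune (ts ! i) {p. i # p \<in> I}) ?js"
  have "List.map_filter id (map Rep_ptree
      (map (\<lambda>i. rcontract (ts ! i) {p. i # p \<in> I}) [0..<length ts])) = map suppress ?us"
    by (auto simp: List.map_filter_def filter_map o_def rcontract.rep_eq intro!: map_cong filter_cong)
  then have "Rep_ptree (graft (map (\<lambda>i. rcontract (ts ! i) {p. i # p \<in> I}) [0..<length ts])) =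
      graft_nonempty (map suppress ?us)"
    by (simp add: graft.rep_eq)
  moreover have "Rep_ptree (rcontract (Vertex ts) I) = graft_nonempty (map suppress ?us)"
  proof (cases "I = {}")
    case True
    then show ?thesis by (simp add: rcontract.rep_eq graft_nonempty_def)
  next
    case False
    \<comment> \<open>As \<open>ts\<close> is nonempty, an address in \<open>I\<close> cannot be
      \<open>[]\<close>, so it passes through some child.\<close>
    then have "?us \<noteq> []"
      using assms by (fastforce simp: filter_empty_conv)
    from suppress_Vertex[OF this] False show ?thesis
      by (simp only: rcontract.rep_eq prune.simps if_False)
  qed
  ultimately show "Rep_ptree (rcontract (Vertex ts) I) =
      Rep_ptree (graft (map (\<lambda>i. rcontract (ts ! i) {p. i # p \<in> I}) [0..<length ts]))"
    by simp
qed

text \<open>A leaf set of the whole tree amounts to an independent choice of a leaf set in each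
  branch; prefixing by the child position and slicing by it are mutually inverse.\<close>

lemma sum_Pow_rleaves_Vertex:
  assumes "ts \<noteq> []"
  shows "(\<Sum>Is\<in>listset (map (\<lambda>t. Pow (rleaves t)) ts). basis (graft (map2 rcontract ts Is))) =
    (\<Sum>I\<in>Pow (rleaves (Vertex ts)). basis (rcontract (Vertex ts) I))"
proof (rule sum.reindex_bij_witness
    [where i = "\<lambda>I. map (\<lambda>i. {p. i # p \<in> I}) [0..<length ts]"
       and j = "\<lambda>Is. \<Union>i<length ts. (#) i ` (Is ! i)"])
  fix Is
  assume Is: "Is \<in> listset (map (\<lambda>t. Pow (rleaves t)) ts)"
  let ?I = "\<Union>i<length ts. (#) i ` (Is ! i)"
  show *: "map (\<lambda>i. {p. i # p \<in> ?I}) [0..<length ts] = Is"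
    using Is by (auto simp: in_listset_iff image_iff intro!: nth_equalityI)
  show sub: "?I \<in> Pow (rleaves (Vertex ts))"
    using Is assms by (fastforce simp: in_listset_iff)
  have "map2 rcontract ts (map (\<lambda>i. {p. i # p \<in> ?I}) [0..<length ts]) =
      map (\<lambda>i. rcontract (ts ! i) {p. i # p \<in> ?I}) [0..<length ts]"
    by (rule nth_equalityI) auto
  then show "basis (rcontract (Vertex ts) ?I) = basis (graft (map2 rcontract ts Is))"
    using rcontract_Vertex[OF assms] sub unfolding * by simp
next
  fix I
  assume I: "I \<in> Pow (rleaves (Vertex ts))"
  show "(\<Union>i<length ts. (#) i ` (map (\<lambda>i. {p. i # p \<in> I}) [0..<length ts] ! i)) = I"
    using I assms by (fastforce simp: image_iff)
  show "map (\<lambda>i. {p. i # p \<in> I}) [0..<length ts] \<in> listset (map (\<lambda>t. Pow (rleaves t)) ts)"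
    using I assms by (fastforce simp: in_listset_iff)
qed

lemma subst_tree_one_plus_x:
  "subst_tree t (replicate (card (rleaves t)) (basis empty_tree + basis leaf_tree :: 'k::field planar_poly)) =
     (\<Sum>I\<in>Pow (rleaves t). basis (rcontract t I))"
proof (induction t)
  case (Vertex ts)
  show ?case
  proof (cases "ts = []")
    case True
    \<comment> \<open>The only leaf is the root, with address \<open>[]\<close>; its two subsets
      yield the summands 1 and x.\<close>
    have "rcontract (Vertex []) {} = empty_tree" "rcontract (Vertex []) {[]} = leaf_tree"
      by (transfer, simp)+
    with True show ?thesis
      by (simp add: Pow_insert)
  next
    case False
    then have "subst_tree (Vertex ts)
        (replicate (card (rleaves (Vertex ts))) (basis empty_tree + basis leaf_tree :: 'k planar_poly)) =
      multilinear_extension graft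
        (map (\<lambda>t. \<Sum>I\<in>Pow (rleaves t). basis (rcontract t I)) ts)"
      unfolding subst_tree_Vertex_replicate[OF False]
      by (intro arg_cong[where f = "multilinear_extension graft"] map_cong refl Vertex.IH)
    also have "\<dots> = (\<Sum>Is\<in>listset (map (\<lambda>t. Pow (rleaves t)) ts).
        basis (graft (map2 rcontract ts Is)))"
      by (rule multilinear_extension_sum_basis) (simp add: finite_rleaves)
    also have "\<dots> = (\<Sum>I\<in>Pow (rleaves (Vertex ts)). basis (rcontract (Vertex ts) I))"
      by (rule sum_Pow_rleaves_Vertex[OF False])
    finally show ?thesis .
  qed
qed

lemma tree_power_one_plus_x:
  "tree_power (basis empty_tree + basis leaf_tree) T = (\<Sum>I\<in>Pow (leaves T). basis (contract T I))"
proof (cases "Rep_ptree T")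
  case None
  then have "contract T {} = empty_tree"
    by transfer simp
  with None show ?thesis
    by (simp add: tree_power_def leaves.rep_eq)
next
  case (Some t)
  then show ?thesis
    by (simp add: tree_power_def leaves.rep_eq subst_tree_one_plus_x contract_eq_rcontract)
qed

theorem proposition4p2:
  fixes T :: ptree
  shows "tree_power (basis empty_tree + basis leaf_tree :: 'k::field planar_poly) T =
    Sum_any (\<lambda>S. scale (of_nat (tree_binomial T S)) (basis S))"
proof -
  let ?P = "Pow (leaves T)"
  have fin: "finite ?P"
    by (simp add: finite_leaves)
  \<comment> \<open>Leaf sets are grouped by their contraction; each group has size
    \<open>tree_binomial T S\<close>.\<close>
  have "tree_power (basis empty_tree + basis leaf_tree :: 'k planar_poly) T =
      (\<Sum>S\<in>contract T ` ?P. \<Sum>I\<in>{I \<in> ?P. contract T I = S}. basis (contract T I))"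
    unfolding tree_power_one_plus_x using fin by (rule sum.image_gen)
  also have "\<dots> = (\<Sum>S\<in>contract T ` ?P. scale (of_nat (tree_binomial T S)) (basis S))"
    by (simp add: sum_const_scale tree_binomial_def)
  also have "\<dots> = Sum_any (\<lambda>S. scale (of_nat (tree_binomial T S)) (basis S))"
  proof (rule Sum_any.expand_superset[symmetric])
    \<comment> \<open>Outside the image of \<open>contract T\<close> the binomial is 0, so the sum
      over all trees reduces to a finite one.\<close>
    show "{S. scale (of_nat (tree_binomial T S)) (basis S :: 'k planar_poly) \<noteq> 0} \<subseteq> contract T ` ?P"
    proof
      fix S
      assume "S \<in> {S. scale (of_nat (tree_binomial T S)) (basis S :: 'k planar_poly) \<noteq> 0}"
      then have "tree_binomial T S \<noteq> 0"
        by (metis (mono_tags) mem_Collect_eq of_nat_0 scale_zero)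
      then show "S \<in> contract T ` ?P"
        by (auto simp: tree_binomial_def card_eq_0_iff)
    qed
  qed (use fin in simp)
  finally show ?thesis .
qed

end
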